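(* Let $F(t)=\frac{1}{2}(t^2-t+1)$ and $G(t)=\frac{1}{4}(t^2+t+1)(t^2-t+3)$. Let $f,g\in\mathbb{Q}[t]$ with $\deg f=2$, $\deg g=4$, and call $(f,g)$ a solution if $g$ divides $f^3+1$ and $f$ divides $g^3+1$ in $\mathbb{Q}[t]$. Call $(f,g)$ trivial if there exist $f_1,g_1,h\in\mathbb{Q}[t]$ with $\deg h\ge 2$ such that $f=f_1\circ h$ and $g=g_1\circ h$. Then $(f,g)$ is a non-trivial solution if and only if there exist $\alpha\in\mathbb{Q}\setminus\{0\}$ and $\beta\in\mathbb{Q}$ such that $f(t)=F(\alpha t+\beta)$ and $g(t)=G(\alpha t+\beta)$.
   Context: Non-trivial solutions are considered only up to affine reparametrization $t\mapsto\alpha t+\beta$ with $\alpha\in\mathbb{Q}\setminus\{0\}$, $\beta\in\mathbb{Q}$. *)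

theory Defs
  imports "HOL-Computational_Algebra.Polynomial"
begin

definition F :: "rat poly" where
  "F = smult (1/2) [:1, -1, 1:]"

definition G :: "rat poly" where
  "G = smult (1/4) ([:1, 1, 1:] * [:3, -1, 1:])"

definition is_solution :: "rat poly \<Rightarrow> rat poly \<Rightarrow> bool" where
  "is_solution f g \<longleftrightarrow> g dvd f ^ 3 + 1 \<and> f dvd g ^ 3 + 1"

definition is_trivial :: "rat poly \<Rightarrow> rat poly \<Rightarrow> bool" where
  "is_trivial f g \<longleftrightarrow>
     (\<exists>f\<^sub>1 g\<^sub>1 h. degree h \<ge> 2 \<and> f = f\<^sub>1 \<circ>\<^sub>p h \<and> g = g\<^sub>1 \<circ>\<^sub>p h)"

end

theory Submission
  imports Defs
begin

text \<open>
  Write f ^ 3 + 1 = g q with q quadratic, and shift t so that f is even. If q is even then so is g,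
  and the solution is trivial. Otherwise f is congruent modulo q to a non-constant linear
  polynomial w, and a quadratic dividing w ^ 3 + 1 over the rationals must divide w ^ 2 - w + 1.
  Hence q divides f ^ 2 - f + 1, whose cofactor u is proportional to q(-t), and g = (f + 1) u.
  Now f divides u ^ 3 + 1, and the same argument makes f proportional to r ^ 2 - r + 1, where r is
  the linear residue of u modulo f. Comparing coefficients leaves a single parameter, the slope
  of r.
\<close>

section \<open>Quadratic divisors of the cube of a linear polynomial plus one\<close>

lemma rat_square_diff_plus_one_nonzero: "(x::rat)\<^sup>2 - x + 1 \<noteq> 0"
proof -
  have "x\<^sup>2 - x + 1 = (x - 1/2)\<^sup>2 + 3/4"
    by (simp add: power2_eq_square algebra_simps)
  also have "\<dots> > 0"
    by (intro add_nonneg_pos) auto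
  finally show ?thesis by simp
qed

lemma degree4_coeffs:
  assumes "degree (p::'a::zero poly) = 4"
  obtains a b c d e where "p = [:a, b, c, d, e:]"
proof -
  have "p = [:coeff p 0, coeff p 1, coeff p 2, coeff p 3, coeff p 4:]"
    using assms coeff_eq_0[of p]
    by (intro poly_eqI) (auto simp: coeff_pCons numeral_eq_Suc split: nat.split)
  then show ?thesis using that by blast
qed

text \<open>In \<open>r ^ 3 + 1 = (r + 1) * (r\<^sup>2 - r + 1)\<close> the second factor has no
  rational root. If \<open>p\<close> contained the linear factor \<open>r + 1\<close>, its other
  linear factor would divide the second one; so \<open>r + 1\<close> sits in the cofactor of
  \<open>p\<close>.\<close>

lemma quadratic_dvd_linear_cube_plus_one:
  fixes p r :: "rat poly"
  assumes "degree p = 2" "degree r = 1" "p dvd r ^ 3 + 1"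
  obtains k where "r\<^sup>2 - r + 1 = smult k p"
proof -
  define s where "s = r + 1"
  have ds: "degree s = 1"
    using assms(2) unfolding s_def by (simp add: degree_add_eq_left)
  then have s0: "s \<noteq> 0" by auto
  obtain b a where s: "s = [:b, a:]" "a \<noteq> 0"
    using ds by (elim degree1_coeffs)
  define x where "x = - b / a"
  have s_dvd: "s dvd h" if "poly h x = 0" for h
  proof -
    have "s = smult a [:- x, 1:]" using s by (simp add: x_def)
    then show ?thesis using that s(2) by (metis poly_eq_0_iff_dvd smult_dvd)
  qed
  have sx: "poly s x = 0" using s by (simp add: x_def)
  have fact: "r ^ 3 + 1 = s * (r\<^sup>2 - r + 1)"
    unfolding s_def by (simp add: power2_eq_square power3_eq_cube algebra_simps)
  obtain h where h: "r ^ 3 + 1 = p * h" using assms(3) by blast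
  have noroot: "poly (r\<^sup>2 - r + 1) y \<noteq> 0" for y
    using rat_square_diff_plus_one_nonzero[of "poly r y"] by simp
  have "poly p x \<noteq> 0"
  proof
    assume "poly p x = 0"
    then obtain l where l: "p = s * l" using s_dvd by blast
    have "s * (r\<^sup>2 - r + 1) = s * (l * h)" using fact h l by (metis mult.assoc)
    then have eq: "r\<^sup>2 - r + 1 = l * h" using s0 mult_left_cancel by blast
    have "l \<noteq> 0" using l assms(1) by auto
    then have "degree l = 1"
      using l assms(1) ds s0 by (simp add: degree_mult_eq)
    then obtain l0 l1 where ll: "l = [:l0, l1:]" "l1 \<noteq> 0"
      by (elim degree1_coeffs)
    then have "poly l (- l0 / l1) = 0" by simp
    then show False using noroot[of "- l0 / l1"] eq by simp
  qed
  moreover have "poly p x * poly h x = 0"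
    using sx fact h by (metis mult_zero_left poly_mult)
  ultimately obtain k where k: "h = s * k" using s_dvd by auto
  have "s * (r\<^sup>2 - r + 1) = s * (p * k)" using fact h k by (metis mult.left_commute)
  then have eq: "r\<^sup>2 - r + 1 = p * k" using s0 mult_left_cancel by blast
  have k0: "k \<noteq> 0" and p0: "p \<noteq> 0" using noroot[of 0] eq by auto
  obtain d c where r: "r = [:d, c:]" "c \<noteq> 0"
    using assms(2) by (elim degree1_coeffs)
  have "degree (r\<^sup>2 - r + 1) \<le> 2"
    unfolding r by (simp add: power2_eq_square one_pCons)
  then have "degree k = 0" using eq k0 p0 assms(1) by (simp add: degree_mult_eq)
  then obtain k' where "k = [:k':]" by (metis degree_eq_zeroE)
  then show ?thesis using eq that[of k'] by simp
qed

lemma dvd_cube_plus_one_cong: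
  fixes p q r :: "'a::comm_ring_1"
  assumes "p dvd q - r" "p dvd q ^ 3 + 1"
  shows "p dvd r ^ 3 + 1"
proof -
  have "r ^ 3 + 1 = (q ^ 3 + 1) - (q - r) * (q\<^sup>2 + q * r + r\<^sup>2)"
    by (simp add: power2_eq_square power3_eq_cube algebra_simps)
  then show ?thesis using assms by (metis dvd_diff dvd_mult2)
qed

section \<open>Non-trivial solutions with even f\<close>

lemma trivial_if_even:
  "is_trivial [:c, 0, a:] [:g0, 0, g2, 0, g4:]"
proof -
  have "[:c, 0, a:] = [:c, a:] \<circ>\<^sub>p [:0, 0, 1:]"
       "[:g0, 0, g2, 0, g4:] = [:g0, g2, g4:] \<circ>\<^sub>p [:0, 0, 1:]"
    by (simp_all add: pcompose_pCons)
  moreover have "degree [:0, 0, 1::rat:] \<ge> 2" by simp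
  ultimately show ?thesis unfolding is_trivial_def by blast
qed

text \<open>Here f = a t ^ 2 + c and u = k (t ^ 2 + m t + n). The first three equations say that the residue
  r = k (m t + n - c / a) of u modulo f satisfies r ^ 2 - r + 1 = \<kappa> f, the last two that
  t ^ 2 + m t + n divides f ^ 2 - f + 1. The scale-invariant quantity k m ^ 2 is a root of
  z ^ 3 (z - 2).\<close>

lemma coefficients_determined:
  fixes a c k m n \<kappa> :: rat
  assumes "a \<noteq> 0" "k \<noteq> 0" "m \<noteq> 0"
    and a: "(k * m)\<^sup>2 = \<kappa> * a"
    and lin: "2 * (k * m) * (k * (n - c / a)) = k * m"
    and c: "(k * (n - c / a))\<^sup>2 - k * (n - c / a) + 1 = \<kappa> * c"
    and mid: "a * (2 * n - m\<^sup>2) = 2 * c - 1"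
    and const: "a\<^sup>2 * n\<^sup>2 = c\<^sup>2 - c + 1"
  shows "k * m\<^sup>2 = 2 \<and> a = (k * m)\<^sup>2 / 2 \<and> c = 3 / 8 \<and> k * n = 7 / 8"
proof -
  have half: "k * (n - c / a) = 1/2" using lin assms(2,3) by (simp add: mult_ac)
  have kc: "\<kappa> * c = 3/4" using c unfolding half by (simp add: power2_eq_square)
  have k0: "\<kappa> \<noteq> 0" using kc by auto
  define z where "z = k * m\<^sup>2"
  have z0: "z \<noteq> 0" using assms by (simp add: z_def)
  \<comment> \<open>Since \<open>k * z = (k * m)\<^sup>2 = \<kappa> * a\<close>, multiplying by
    \<open>c\<close> eliminates \<open>\<kappa>\<close> through \<open>kc\<close>.\<close>
  have ca: "c * (k * z) = 3/4 * a"
    using a kc k0 unfolding z_def by (simp add: power2_eq_square) algebra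
  have c': "c = 3/4 * a / (k * z)" using ca z0 assms(2) by (simp add: field_simps)
  have kn: "k * n = 1/2 + 3/4 / z"
  proof -
    have "k * (c / a) = 3/4 / z"
      using assms(1,2) z0 unfolding c' by (simp add: field_simps)
    then show ?thesis using half by (simp add: right_diff_distrib)
  qed
  \<comment> \<open>Like \<open>z\<close>, \<open>e\<close> is invariant under scaling t, so
    \<open>mid\<close> and \<open>const\<close> become equations in \<open>e\<close> and
    \<open>z\<close> alone.\<close>
  define e where "e = a / (k * z)"
  have a': "a = e * k * z" and ce: "c = 3/4 * e"
    using z0 assms(2) c' by (simp_all add: e_def)
  have "a * (2 * n - m\<^sup>2) = e * z * (2 * (k * n) - z)"
    unfolding a' z_def by (simp add: algebra_simps power2_eq_square)
  also have "\<dots> = e * (z + 3/2 - z\<^sup>2)"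
    unfolding kn using z0 by (simp add: field_simps power2_eq_square)
  finally have E1: "e * (z\<^sup>2 - z) = 1"
    using mid unfolding ce by (simp add: algebra_simps)
  have "a\<^sup>2 * n\<^sup>2 = e\<^sup>2 * (z * (k * n))\<^sup>2"
    unfolding a' by (simp add: algebra_simps power2_eq_square)
  also have "z * (k * n) = z / 2 + 3/4" unfolding kn using z0 by (simp add: field_simps)
  finally have E2: "e\<^sup>2 * (z / 2 + 3/4)\<^sup>2 = 9/16 * e\<^sup>2 - 3/4 * e + 1"
    using const unfolding ce by (simp add: power2_eq_square)
  \<comment> \<open>Replacing 1 by \<open>e * (z\<^sup>2 - z)\<close> makes \<open>E2\<close>
    homogeneous of degree 2 in \<open>e\<close>.\<close>
  have "e\<^sup>2 * (z ^ 3 * (z - 2)) = 0"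
  proof -
    have "e\<^sup>2 * (z ^ 3 * (z - 2))
        = (e * (z\<^sup>2 - z))\<^sup>2 - 3/4 * e * (e * (z\<^sup>2 - z)) + 9/16 * e\<^sup>2 - e\<^sup>2 * (z / 2 + 3/4)\<^sup>2"
      by (simp add: field_simps power2_eq_square power3_eq_cube)
    then show ?thesis unfolding E1 E2 by simp
  qed
  moreover have "e \<noteq> 0" using E1 by auto
  ultimately have z2: "z = 2" using z0 by simp
  have e: "e = 1/2" using E1 unfolding z2 by simp
  have "(k * m)\<^sup>2 = k * z" by (simp add: z_def power2_eq_square)
  then show ?thesis using a' ce kn z2 e by (simp add: z_def)
qed

lemma solution_even_quadratic:
  fixes a c :: rat and g :: "rat poly"
  assumes a0: "a \<noteq> 0" and dg: "degree g = 4"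
    and sol: "is_solution [:c, 0, a:] g" and nt: "\<not> is_trivial [:c, 0, a:] g"
  shows "\<exists>\<alpha> \<beta>. \<alpha> \<noteq> 0 \<and> [:c, 0, a:] = F \<circ>\<^sub>p [:\<beta>, \<alpha>:] \<and> g = G \<circ>\<^sub>p [:\<beta>, \<alpha>:]"
proof -
  define f where "f = [:c, 0, a:]"
  have df: "degree f = 2" using a0 by (simp add: f_def)
  obtain q where q: "f ^ 3 + 1 = g * q"
    using sol unfolding is_solution_def f_def by blast
  have d6: "degree (f ^ 3 + 1) = 6"
    using df a0 by (subst degree_add_eq_left) (auto simp: degree_power_eq f_def)
  then have "q \<noteq> 0" "g \<noteq> 0" using q by auto
  then have "degree q = 2" using q d6 dg by (simp add: degree_mult_eq)
  then obtain q0 q1 q2 where qq: "q = [:q0, q1, q2:]" "q2 \<noteq> 0"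
    by (elim degree2_coeffs)
  obtain g0 g1 g2 g3 g4 where gg: "g = [:g0, g1, g2, g3, g4:]"
    using dg by (elim degree4_coeffs)
  \<comment> \<open>As \<open>f ^ 3 + 1\<close> is even, the coefficients of degree 5, 3 and 1 of
    \<open>g * q\<close> vanish.\<close>
  have odd: "g4 * q1 + g3 * q2 = 0" "g3 * q0 + (g2 * q1 + g1 * q2) = 0" "g1 * q0 + g0 * q1 = 0"
    using q unfolding f_def gg qq(1) by (simp_all add: power3_eq_cube one_pCons algebra_simps)
  have q1: "q1 \<noteq> 0"
  proof
    assume "q1 = 0"
    then have "g3 = 0" "g1 = 0" using odd qq(2) by auto
    then show False using nt trivial_if_even gg by auto
  qed

  \<comment> \<open>The remainder of \<open>f\<close> modulo \<open>q\<close>; it is non-constant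
    because \<open>q1\<close> is nonzero, which is where non-triviality enters.\<close>
  define w where "w = [:c - a * q0 / q2, - a * q1 / q2:]"
  have "f - w = q * [:a / q2:]"
    using qq(2) unfolding f_def w_def qq(1) by simp
  then have qfw: "q dvd f - w" by (metis dvd_triv_left)
  have "q dvd w ^ 3 + 1"
    using qfw q by (intro dvd_cube_plus_one_cong[of q f w]) auto
  moreover have "degree w = 1" using a0 q1 qq(2) by (simp add: w_def)
  ultimately obtain k1 where k1: "w\<^sup>2 - w + 1 = smult k1 q"
    using quadratic_dvd_linear_cube_plus_one \<open>degree q = 2\<close> by metis
  have "f\<^sup>2 - f + 1 = (f - w) * (f + w - 1) + (w\<^sup>2 - w + 1)"
    by (simp add: power2_eq_square algebra_simps)
  also have "q dvd \<dots>" using qfw k1 by (simp add: dvd_smult)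
  finally obtain u where u: "f\<^sup>2 - f + 1 = q * u" by blast
  have "q * ((f + 1) * u) = (f + 1) * (f\<^sup>2 - f + 1)" using u by (simp add: mult_ac)
  also have "\<dots> = q * g"
    using q by (simp add: power2_eq_square power3_eq_cube algebra_simps)
  finally have g: "g = (f + 1) * u" using \<open>q \<noteq> 0\<close> by simp
  have u0: "u \<noteq> 0" and f10: "f + 1 \<noteq> 0" using g \<open>g \<noteq> 0\<close> by auto
  have "degree (f + 1) = 2" using a0 by (simp add: f_def one_pCons)
  then have "degree u = 2" using g dg u0 f10 by (simp add: degree_mult_eq)
  then obtain v0 v1 k where uu: "u = [:v0, v1, k:]" "k \<noteq> 0" by (elim degree2_coeffs)
  have co: "c\<^sup>2 - c + 1 = q0 * v0" "q0 * v1 + q1 * v0 = 0"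
      "2 * a * c - a = q0 * k + q1 * v1 + q2 * v0" "q1 * k + q2 * v1 = 0" "a\<^sup>2 = q2 * k"
    using u unfolding f_def qq(1) uu(1)
    by (simp_all add: power2_eq_square one_pCons algebra_simps)
  \<comment> \<open>Thus \<open>q\<close> is \<open>q2\<close> times t^2 - m t + n. The sign of
    \<open>m\<close> is chosen for \<open>u\<close>, whose coefficients turn out to be
    \<open>k\<close> times those of the reflection t^2 + m t + n.\<close>
  define m n where "m = - q1 / q2" and "n = q0 / q2"
  have qmn: "q1 = - m * q2" "q0 = n * q2" using qq(2) by (simp_all add: m_def n_def)
  have m0: "m \<noteq> 0" using q1 qmn by auto
  have "q2 * v1 = q2 * (k * m)" using co(4) qmn by (simp add: algebra_simps)
  then have v1: "v1 = k * m" using qq(2) by simp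
  have "q2 * m * v0 = q2 * m * (k * n)" using co(2) unfolding qmn v1 by (auto simp: algebra_simps)
  then have v0: "v0 = k * n" using qq(2) m0 by simp
  have mid: "a * (2 * n - m\<^sup>2) = 2 * c - 1"
  proof -
    have "a * (a * (2 * n - m\<^sup>2)) = a * (2 * c - 1)"
      using co(3) co(5) unfolding qmn v0 v1
      by (simp add: algebra_simps power2_eq_square) algebra
    then show ?thesis using a0 by simp
  qed
  have const: "a\<^sup>2 * n\<^sup>2 = c\<^sup>2 - c + 1"
    using co(1,5) unfolding qmn v0 by (simp add: algebra_simps power2_eq_square)

  \<comment> \<open>The remainder of \<open>u\<close> modulo \<open>f\<close>, hence also that of
    \<open>g = (f + 1) * u\<close>.\<close>
  define r where "r = [:k * (n - c / a), k * m:]"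
  have "g - r = f * (u + [:k / a:])"
    using a0 unfolding g uu v0 v1 r_def f_def by (simp add: one_pCons algebra_simps)
  then have "f dvd g - r" by simp
  then have "f dvd r ^ 3 + 1"
    using sol unfolding is_solution_def f_def[symmetric] by (auto intro: dvd_cube_plus_one_cong)
  moreover have "degree r = 1" using uu(2) m0 by (simp add: r_def)
  ultimately obtain \<kappa> where kap: "r\<^sup>2 - r + 1 = smult \<kappa> f"
    using quadratic_dvd_linear_cube_plus_one df by metis
  have "coeff (r\<^sup>2 - r + 1) i = coeff (smult \<kappa> f) i" for i using kap by simp
  from this[of 0] this[of 1] this[of 2]
  have "(k * m)\<^sup>2 = \<kappa> * a"
    "2 * (k * m) * (k * (n - c / a)) = k * m"
    "(k * (n - c / a))\<^sup>2 - k * (n - c / a) + 1 = \<kappa> * c"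
    unfolding r_def f_def by (simp_all add: power2_eq_square numeral_2_eq_2 one_pCons)
  from coefficients_determined[OF a0 uu(2) m0 this mid const]
  have fin: "k * m\<^sup>2 = 2" "a = (k * m)\<^sup>2 / 2" "c = 3 / 8" "k * n = 7 / 8" by auto
  \<comment> \<open>The slope of \<open>r\<close> is the one remaining parameter. The shift below is
    1/2 because \<open>F\<close> is symmetric about 1/2 and \<open>f\<close> about 0.\<close>
  define \<alpha> where "\<alpha> = k * m"
  have "k * (k * m\<^sup>2) = \<alpha>\<^sup>2" by (simp add: \<alpha>_def power2_eq_square)
  then have k: "k = \<alpha>\<^sup>2 / 2" unfolding fin by simp
  have "\<alpha> \<noteq> 0" using uu m0 by (simp add: \<alpha>_def)
  moreover have "f = F \<circ>\<^sub>p [:1/2, \<alpha>:]"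
    unfolding f_def F_def fin(2,3) \<alpha>_def[symmetric]
    by (simp add: pcompose_pCons pcompose_smult power2_eq_square)
  moreover have "g = G \<circ>\<^sub>p [:1/2, \<alpha>:]"
  proof -
    have "u = [:7/8, \<alpha>, k:]" unfolding uu(1) v0 v1 fin(4) \<alpha>_def ..
    then have u': "u = [:7/8, \<alpha>, \<alpha>\<^sup>2 / 2:]" by (subst (asm) k)
    \<comment> \<open>At x = \<alpha> t + 1/2 the factors of \<open>G\<close> match those of
      \<open>g\<close>: x^2 + x + 1 is \<open>2 * u\<close> and x^2 - x + 3 is
      \<open>2 * (f + 1)\<close>.\<close>
    show ?thesis
      unfolding g u' f_def fin(2,3) \<alpha>_def[symmetric] G_def
      by (simp add: pcompose_pCons pcompose_smult pcompose_mult power2_eq_square one_pCons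
        algebra_simps)
  qed
  ultimately show ?thesis unfolding f_def by blast
qed

section \<open>Invariance under affine reparametrization\<close>

lemma pcompose_dvd_mono:
  fixes p q h :: "'a::comm_ring_1 poly"
  shows "p dvd q \<Longrightarrow> p \<circ>\<^sub>p h dvd q \<circ>\<^sub>p h"
  by (auto simp: dvd_def pcompose_mult)

lemma pcompose_cube_plus_one:
  fixes p h :: "'a::comm_ring_1 poly"
  shows "(p ^ 3 + 1) \<circ>\<^sub>p h = (p \<circ>\<^sub>p h) ^ 3 + 1"
  by (simp add: power3_eq_cube pcompose_add pcompose_mult one_pCons pcompose_pCons)

lemma is_solution_pcompose:
  "is_solution f g \<Longrightarrow> is_solution (f \<circ>\<^sub>p h) (g \<circ>\<^sub>p h)"
  unfolding is_solution_def by (metis pcompose_cube_plus_one pcompose_dvd_mono)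

lemma is_trivial_pcompose_linear:
  assumes "is_trivial f g" "\<alpha> \<noteq> 0"
  shows "is_trivial (f \<circ>\<^sub>p [:\<beta>, \<alpha>:]) (g \<circ>\<^sub>p [:\<beta>, \<alpha>:])"
proof -
  obtain f1 g1 h where "degree h \<ge> 2" "f = f1 \<circ>\<^sub>p h" "g = g1 \<circ>\<^sub>p h"
    using assms(1) unfolding is_trivial_def by blast
  then have "degree (h \<circ>\<^sub>p [:\<beta>, \<alpha>:]) \<ge> 2" "f \<circ>\<^sub>p [:\<beta>, \<alpha>:] = f1 \<circ>\<^sub>p (h \<circ>\<^sub>p [:\<beta>, \<alpha>:])"
    "g \<circ>\<^sub>p [:\<beta>, \<alpha>:] = g1 \<circ>\<^sub>p (h \<circ>\<^sub>p [:\<beta>, \<alpha>:])"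
    using assms(2) by (simp_all add: pcompose_assoc degree_pcompose)
  then show ?thesis unfolding is_trivial_def by blast
qed

lemma pcompose_linear_inverse:
  fixes p :: "'a::field poly"
  assumes "\<alpha> \<noteq> 0"
  shows "p \<circ>\<^sub>p [:\<beta>, \<alpha>:] \<circ>\<^sub>p [:- \<beta> / \<alpha>, 1 / \<alpha>:] = p"
    and "p \<circ>\<^sub>p [:- \<beta> / \<alpha>, 1 / \<alpha>:] \<circ>\<^sub>p [:\<beta>, \<alpha>:] = p"
  using assms by (simp_all add: pcompose_assoc[symmetric] pcompose_pCons)

section \<open>The pair F, G is a non-trivial solution\<close>

lemma is_solution_F_G: "is_solution F G"
proof -
  \<comment> \<open>The cofactor is half the image of t^2 + t + 1 under t to 1 - t, the symmetry of
    \<open>F\<close>.\<close>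
  have "F ^ 3 + 1 = G * smult (1/2) [:3, -3, 1:]"
    unfolding F_def G_def by (simp add: power3_eq_cube one_pCons)
  moreover have "F dvd G ^ 3 + 1"
  proof -
    \<comment> \<open>\<open>G\<close> is \<open>F + 1\<close> times (t^2 + t + 1)/2, and the latter
      equals \<open>F\<close> plus t; so \<open>G\<close> is congruent to t modulo
      \<open>F\<close>.\<close>
    have "G - [:0, 1:] = F * ([:1, 1, 1:] * [:1/2:] + 1)"
      unfolding F_def G_def by (simp add: one_pCons)
    then have "F dvd [:0, 1:] - G" by (metis dvd_diff_commute dvd_triv_left)
    moreover have "[:0, 1:] ^ 3 + 1 = F * [:2, 2:]"
      unfolding F_def by (simp add: power3_eq_cube one_pCons)
    ultimately show ?thesis by (metis dvd_cube_plus_one_cong dvd_triv_left)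
  qed
  ultimately show ?thesis unfolding is_solution_def by (metis dvd_triv_left)
qed

text \<open>A common inner polynomial h would be affine in F, so G would take equal values at 0 and 1,
  where F does.\<close>

lemma not_is_trivial_F_G: "\<not> is_trivial F G"
proof
  assume "is_trivial F G"
  then obtain f1 g1 h where h: "degree h \<ge> 2" and f: "F = f1 \<circ>\<^sub>p h" and g: "G = g1 \<circ>\<^sub>p h"
    unfolding is_trivial_def by blast
  have "degree f1 * degree h = 2"
    using arg_cong[OF f, of degree] by (simp add: degree_pcompose F_def)
  then have "degree f1 = 1"
    using h by (cases "degree f1"; cases "degree f1 - 1") auto
  then obtain b a where f1: "f1 = [:b, a:]" "a \<noteq> 0" by (elim degree1_coeffs)
  have "poly F 0 = poly F 1" by (simp add: F_def)
  then have "poly h 0 = poly h 1" using f1 unfolding f by (simp add: poly_pcompose)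
  then have "poly G 0 = poly G 1" unfolding g by (simp add: poly_pcompose)
  then show False by (simp add: G_def)
qed

theorem theorem2p4:
  fixes f g :: "rat poly"
  assumes "degree f = 2" and "degree g = 4"
  shows "(is_solution f g \<and> \<not> is_trivial f g) \<longleftrightarrow>
    (\<exists>\<alpha> \<beta> :: rat. \<alpha> \<noteq> 0 \<and> f = F \<circ>\<^sub>p [:\<beta>, \<alpha>:] \<and> g = G \<circ>\<^sub>p [:\<beta>, \<alpha>:])"
proof (intro iffI conjI; (elim conjE exE)?)
  assume sol: "is_solution f g" and nt: "\<not> is_trivial f g"
  obtain c b a where f: "f = [:c, b, a:]" "a \<noteq> 0" using assms(1) by (elim degree2_coeffs)
  \<comment> \<open>Completing the square: replacing t by t - s removes the linear term of
    \<open>f\<close>.\<close>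
  define s where "s = b / (2 * a)"
  have inv: "p \<circ>\<^sub>p [:- s, 1:] \<circ>\<^sub>p [:s, 1:] = p" for p :: "rat poly"
    using pcompose_linear_inverse(2)[of 1 p s] by simp
  define c' where "c' = c - b * s + a * s\<^sup>2"
  have f': "f \<circ>\<^sub>p [:- s, 1:] = [:c', 0, a:]"
    using f by (simp add: pcompose_pCons c'_def s_def power2_eq_square field_simps)
  define g' where "g' = g \<circ>\<^sub>p [:- s, 1:]"
  have "is_solution [:c', 0, a:] g'"
    using is_solution_pcompose[OF sol] f' g'_def by metis
  \<comment> \<open>A common inner polynomial of the shifted pair, shifted back by \<open>s\<close>,
    would serve for \<open>f\<close> and \<open>g\<close>.\<close>
  moreover have "\<not> is_trivial [:c', 0, a:] g'"
    using is_trivial_pcompose_linear[of _ _ 1 s] nt inv f' g'_def by (metis one_neq_zero)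
  moreover have "degree g' = 4" using assms(2) by (simp add: g'_def degree_pcompose)
  ultimately obtain \<alpha> \<beta> where ab: "\<alpha> \<noteq> 0"
    "[:c', 0, a:] = F \<circ>\<^sub>p [:\<beta>, \<alpha>:]" "g' = G \<circ>\<^sub>p [:\<beta>, \<alpha>:]"
    using solution_even_quadratic[OF f(2)] by blast
  have comp: "[:\<beta>, \<alpha>:] \<circ>\<^sub>p [:s, 1:] = [:\<beta> + \<alpha> * s, \<alpha>:]"
    by (simp add: pcompose_pCons mult_ac)
  have "f = F \<circ>\<^sub>p [:\<beta>, \<alpha>:] \<circ>\<^sub>p [:s, 1:]" "g = G \<circ>\<^sub>p [:\<beta>, \<alpha>:] \<circ>\<^sub>p [:s, 1:]"
    using inv[of f] inv[of g] f' g'_def ab by auto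
  then show "\<exists>\<alpha> \<beta>. \<alpha> \<noteq> 0 \<and> f = F \<circ>\<^sub>p [:\<beta>, \<alpha>:] \<and> g = G \<circ>\<^sub>p [:\<beta>, \<alpha>:]"
    unfolding pcompose_assoc[symmetric] comp using ab(1) by blast
next
  fix \<alpha> \<beta> :: rat
  assume fg: "\<alpha> \<noteq> 0" "f = F \<circ>\<^sub>p [:\<beta>, \<alpha>:]" "g = G \<circ>\<^sub>p [:\<beta>, \<alpha>:]"
  show "is_solution f g" unfolding fg by (rule is_solution_pcompose[OF is_solution_F_G])
  show "\<not> is_trivial f g"
  \<comment> \<open>The inverse affine map would carry a decomposition of \<open>f\<close> and
    \<open>g\<close> to one of \<open>F\<close> and \<open>G\<close>.\<close>
  proof
    assume "is_trivial f g"
    then have "is_trivial (f \<circ>\<^sub>p [:- \<beta> / \<alpha>, 1 / \<alpha>:]) (g \<circ>\<^sub>p [:- \<beta> / \<alpha>, 1 / \<alpha>:])"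
      using fg(1) by (intro is_trivial_pcompose_linear) auto
    then show False
      using not_is_trivial_F_G unfolding fg(2,3) pcompose_linear_inverse(1)[OF fg(1)] by simp
  qed
qed

end
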